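(* Let $f:\mathbb{Z}\to[0,\infty)$ be a function and, for $n\ge 1$, put $\breve f(n)=\max\{1,\max_{-n\le i\le n} f(i)\}$. If $$\sum_{n=1}^\infty \frac{1}{\breve f(n)}=\infty,$$ then two independent simple random walks $X=(X_n)_{n\ge0}$ and $X'=(X'_n)_{n\ge0}$ on $\mathrm{Comb}(\mathbb{Z},f)$, started from the same vertex, collide infinitely many times with probability one, i.e. $|\{n: X_n=X'_n\}|=\infty$ almost surely.
   Context: For $f:\mathbb{Z}\to[0,\infty)$, the wedge comb $\mathrm{Comb}(\mathbb{Z},f)$ is the graph with vertex set $\mathbb{V}=\{(x,y): x,y\in\mathbb{Z},\ -f(x)\le y\le f(x)\}$ and edge set $\{[(x,n),(x,m)]: |m-n|=1\}\cup\{[(x,0),(y,0)]: |x-y|=1\}$ (edges between vertices of $\mathbb{V}$). The simple random walk on a graph is the discrete-time Markov chain that at each step jumps from the current vertex to a uniformly chosen neighbour. *)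

theory Defs
  imports "HOL-Probability.Probability"
begin

text \<open>Undirected graphs are given by their edges, which are unordered pairs of vertices.\<close>

definition neighbours :: "'v set set \<Rightarrow> 'v \<Rightarrow> 'v set" where
  "neighbours E u = {v. {u, v} \<in> E}"

definition comb_vertices :: "(int \<Rightarrow> real) \<Rightarrow> (int \<times> int) set" where
  "comb_vertices f = {(x, y). - f x \<le> of_int y \<and> of_int y \<le> f x}"

definition comb_edges :: "(int \<Rightarrow> real) \<Rightarrow> (int \<times> int) set set" where
  "comb_edges f =
     {{(x, n), (x, m)} | x n m. \<bar>m - n\<bar> = 1 \<and> (x, n) \<in> comb_vertices f \<and> (x, m) \<in> comb_vertices f} \<union>
     {{(x, 0), (y, 0)} | x y. \<bar>x - y\<bar> = 1 \<and> (x, 0) \<in> comb_vertices f \<and> (y, 0) \<in> comb_vertices f}"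

text \<open>
  \<^const>\<open>pmf_of_set\<close> is the uniform distribution only on a finite nonempty set. For the
  comb this holds at every vertex by the lemmas below; on a general graph the locale is
  meaningful only if every vertex has finitely many and at least one neighbour.
\<close>

locale simple_random_walk = prob_space M
  for M :: "'a measure" +
  fixes E :: "'v set set" and start :: 'v and X :: "nat \<Rightarrow> 'a \<Rightarrow> 'v"
  assumes measurable_walk: "\<And>n. X n \<in> M \<rightarrow>\<^sub>M count_space UNIV"
    and walk_start: "AE \<omega> in M. X 0 \<omega> = start"
    and walk_step: "\<And>n x v. \<P>(\<omega> in M. \<forall>i\<le>n. X i \<omega> = x i) > 0 \<Longrightarrow>
      \<P>(\<omega> in M. X (Suc n) \<omega> = v \<bar> \<forall>i\<le>n. X i \<omega> = x i) = pmf (pmf_of_set (neighbours E (x n))) v"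

definition breve :: "(int \<Rightarrow> real) \<Rightarrow> nat \<Rightarrow> real" where
  "breve f n = max 1 (Max (f ` {- int n..int n}))"

lemma neighbours_comb_subset:
  "neighbours (comb_edges f) (x, y) \<subseteq> {x - 1..x + 1} \<times> {y - 1..y + 1}"
  by (auto simp: neighbours_def comb_edges_def doubleton_eq_iff)

lemma finite_neighbours_comb: "finite (neighbours (comb_edges f) u)"
  by (cases u) (auto intro: finite_subset[OF neighbours_comb_subset])

lemma neighbours_comb_nonempty:
  assumes f: "\<And>x. 0 \<le> f x" and u: "u \<in> comb_vertices f"
  shows "neighbours (comb_edges f) u \<noteq> {}"
proof -
  obtain x y where [simp]: "u = (x, y)" by (cases u)
  show ?thesis
  proof (cases "y = 0")
    case True
    have "{(x, 0), (x + 1, 0)} \<in> comb_edges f"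
      unfolding comb_edges_def
      by (rule UnI2, rule CollectI, rule exI[of _ x], rule exI[of _ "x + 1"])
        (simp add: comb_vertices_def f)
    with True show ?thesis by (auto simp: neighbours_def)
  next
    case False
    define m where "m = y - sgn y"
    have "(x, m) \<in> comb_vertices f" "\<bar>m - y\<bar> = 1"
      using u f[of x] False by (auto simp: m_def comb_vertices_def sgn_if)
    hence "{(x, y), (x, m)} \<in> comb_edges f"
      using u unfolding comb_edges_def by fastforce
    thus ?thesis by (auto simp: neighbours_def)
  qed
qed

end

theory Submission
  imports Defs
begin

text \<open>
  Why the walks meet. Fix a scale \<open>N\<close> and kill a walker when its first coordinate reaches
  \<open>\<plusminus> N\<close>. The comb is a tree with unit conductances, so the Green function \<open>green N\<close> of this strip is
  explicit: it is the Green function of an interval in the two spine coordinates, plus the length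
  of the common part of the two paths to the spine if both vertices lie on the same tooth. In
  each variable it is harmonic away from the other vertex. A walker at \<open>u\<close> and one at \<open>v\<close> at even
  distance are never neighbours, so moving the walkers one after the other shows that
  \<open>green N\<close> is also harmonic for the \<^emph>\<open>pair\<close> of walkers as long as they are apart
  (\<open>green_pair_harmonic\<close>). It vanishes when one walker is at the boundary, and on the
  diagonal it is at most \<open>D = N / 2 + breve f N\<close>. Hence \<open>green N u v / D\<close> bounds from below the
  probability that the walkers meet before one of them leaves the strip (\<open>never_meet_strip\<close>).

  If both walkers start in the inner half of the strip of half-width \<open>2 ^ Suc k\<close>, then
  \<open>green\<close> is at least \<open>2 ^ k / 4\<close>, so they meet before leaving it with probability at least
  \<open>2 ^ k / (4 * (2 ^ k + breve f (2 ^ Suc k)))\<close>. When one of them leaves without a meeting, both are in the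
  inner half of the next strip, and the argument repeats. By Cauchy condensation the
  divergence of the sum of \<open>1 / breve f n\<close> makes the sum of these bounds over \<open>k\<close> diverge
  (\<open>scale_gain_not_summable\<close>), so the probability of never meeting is at most an infinite product
  equal to zero (\<open>never_meet_eq_0\<close>).

  All of this is a statement about the limit \<open>never_meet\<close> of the solutions of a finite difference
  equation, proved with a minimum principle on a finite set of pairs. The processes enter through
  the cylinder probabilities alone: after any finite history, the probability of no further meeting
  is zero by \<open>avoid_after_path\<close>, and there are countably many finite histories.
\<close>

section \<open>Minimum principle\<close>

definition average :: "'a set \<Rightarrow> ('a \<Rightarrow> real) \<Rightarrow> real" where
  "average A g = (\<Sum>a\<in>A. g a) / real (card A)"

lemma average_mono: "(\<And>a. a \<in> A \<Longrightarrow> g a \<le> h a) \<Longrightarrow> average A g \<le> average A h"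
  unfolding average_def by (intro divide_right_mono sum_mono) auto

lemma average_const: "finite A \<Longrightarrow> A \<noteq> {} \<Longrightarrow> average A (\<lambda>_. c) = c"
  by (simp add: average_def)

lemma average_diff: "average A (\<lambda>a. g a - h a) = average A g - average A h"
  by (simp add: average_def sum_subtractf diff_divide_distrib)

lemma average_cmult: "average A (\<lambda>a. c * g a) = c * average A g"
  by (simp add: average_def sum_distrib_left)

lemma average_cong: "(\<And>a. a \<in> A \<Longrightarrow> g a = h a) \<Longrightarrow> average A g = average A h"
  unfolding average_def by (metis sum.cong)

lemma average_Times: "average (A \<times> B) g = average A (\<lambda>a. average B (\<lambda>b. g (a, b)))"
  by (simp add: average_def sum.cartesian_product card_cartesian_product
      sum_divide_distrib[symmetric] mult.commute)

text \<open>
  At a minimum in the interior the value equals the average over neighbours that are no smaller, so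
  all neighbours are minima too. The rank stands in for connectedness to the boundary: it
  lets one walk from minimum to minimum until the interior is left.
\<close>

lemma minimum_principle:
  fixes w :: "'z \<Rightarrow> real" and rank :: "'z \<Rightarrow> nat"
  assumes fin: "finite D" and z: "z \<in> D"
    and boundary: "\<And>z. z \<in> D \<Longrightarrow> z \<notin> I \<Longrightarrow> 0 \<le> w z"
    and nb: "\<And>z. z \<in> D \<Longrightarrow> z \<in> I \<Longrightarrow> nb z \<subseteq> D"
    and super: "\<And>z. z \<in> D \<Longrightarrow> z \<in> I \<Longrightarrow> average (nb z) w \<le> w z"
    and rank: "\<And>z. z \<in> D \<Longrightarrow> z \<in> I \<Longrightarrow> \<exists>z'\<in>nb z. rank z' < rank z"
  shows "0 \<le> w z"
proof (rule ccontr)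
  assume neg: "\<not> 0 \<le> w z"
  define m where "m = Min (w ` D)"
  have min: "m \<le> w y" if "y \<in> D" for y
    using fin that by (simp add: m_def)
  have "m \<in> w ` D"
    unfolding m_def using fin z by (intro Min_in) auto
  then obtain y0 where "y0 \<in> D \<and> w y0 = m" by auto
  then obtain y where y: "y \<in> D" "w y = m"
    and least: "\<And>y'. y' \<in> D \<and> w y' = m \<Longrightarrow> rank y \<le> rank y'"
    using ex_has_least_nat[of "\<lambda>y. y \<in> D \<and> w y = m" y0 rank] by auto
  have "m < 0" using min[OF z] neg by linarith
  then have I: "y \<in> I" using boundary[of y] y by fastforce
  obtain y' where y': "y' \<in> nb y" "rank y' < rank y" using rank[OF y(1) I] by auto
  have sub: "nb y \<subseteq> D" by (rule nb[OF y(1) I])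
  have fin': "finite (nb y)" using finite_subset[OF sub fin] .
  have card: "0 < card (nb y)" using fin' y'(1) by (auto simp: card_gt_0_iff)
  have "average (nb y) w \<le> m" using super[OF y(1) I] y(2) by simp
  then have "(\<Sum>a\<in>nb y. w a) \<le> m * card (nb y)"
    using card by (simp add: average_def divide_le_eq)
  then have "(\<Sum>a\<in>nb y. w a - m) \<le> 0"
    by (simp add: sum_subtractf mult.commute)
  moreover have "w y' - m \<le> (\<Sum>a\<in>nb y. w a - m)"
    using sub min by (intro member_le_sum[OF y'(1) _ fin']) auto
  moreover have "m \<le> w y'" using min sub y'(1) by auto
  ultimately have "w y' = m" by linarith
  then show False using least[of y'] y' sub by auto
qed

section \<open>Two walkers avoiding each other\<close>

definition pair_neighbours :: "'v set set \<Rightarrow> 'v \<times> 'v \<Rightarrow> ('v \<times> 'v) set" where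
  "pair_neighbours E z = neighbours E (fst z) \<times> neighbours E (snd z)"

text \<open>
  The probability that two independent walkers started at the vertices of \<open>z\<close> are apart at
  all times from \<open>0\<close> to \<open>n\<close>, given by its recursion on the first step.
\<close>

primrec avoid_prob :: "'v set set \<Rightarrow> nat \<Rightarrow> 'v \<times> 'v \<Rightarrow> real" where
  "avoid_prob E 0 z = of_bool (fst z \<noteq> snd z)"
| "avoid_prob E (Suc n) z =
     of_bool (fst z \<noteq> snd z) * average (pair_neighbours E z) (avoid_prob E n)"

definition never_meet :: "'v set set \<Rightarrow> 'v \<times> 'v \<Rightarrow> real" where
  "never_meet E z = lim (\<lambda>n. avoid_prob E n z)"

lemma avoid_prob_nonneg: "0 \<le> avoid_prob E n z"
  by (induction n arbitrary: z) (auto simp: average_def intro!: divide_nonneg_nonneg sum_nonneg)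

lemma average_le_const:
  assumes "\<And>a. a \<in> A \<Longrightarrow> g a \<le> c" "0 \<le> c" shows "average A g \<le> c"
proof (cases "finite A \<and> A \<noteq> {}")
  case True
  then show ?thesis using average_mono[of A g "\<lambda>_. c"] average_const[of A c] assms by auto
next
  case False
  then show ?thesis using assms by (auto simp: average_def)
qed

lemma avoid_prob_le_1: "avoid_prob E n z \<le> 1"
  by (induction n arbitrary: z) (auto intro!: average_le_const)

lemma avoid_prob_antimono: "avoid_prob E (Suc n) z \<le> avoid_prob E n z"
proof (induction n arbitrary: z)
  case 0
  then show ?case by (auto intro!: average_le_const)
next
  case (Suc n)
  have "average (pair_neighbours E z) (avoid_prob E (Suc n))
      \<le> average (pair_neighbours E z) (avoid_prob E n)"
    by (intro average_mono Suc)
  then show ?case by auto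
qed

lemma avoid_prob_tendsto: "(\<lambda>n. avoid_prob E n z) \<longlonglongrightarrow> never_meet E z"
proof -
  have "decseq (\<lambda>n. avoid_prob E n z)" by (rule decseq_SucI) (rule avoid_prob_antimono)
  then obtain l where "(\<lambda>n. avoid_prob E n z) \<longlonglongrightarrow> l"
    using decseq_convergent[of _ 0] avoid_prob_nonneg by metis
  then show ?thesis unfolding never_meet_def by (simp add: limI)
qed

lemma never_meet_nonneg: "0 \<le> never_meet E z"
  by (rule LIMSEQ_le_const[OF avoid_prob_tendsto]) (simp add: avoid_prob_nonneg)

lemma never_meet_le_1: "never_meet E z \<le> 1"
  by (rule LIMSEQ_le_const2[OF avoid_prob_tendsto]) (simp add: avoid_prob_le_1)

lemma never_meet_diagonal: "fst z = snd z \<Longrightarrow> never_meet E z = 0"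
proof -
  assume "fst z = snd z"
  then have "avoid_prob E n z = 0" for n by (cases n) auto
  then have "(\<lambda>n. avoid_prob E n z) \<longlonglongrightarrow> 0" by simp
  then show ?thesis using LIMSEQ_unique[OF avoid_prob_tendsto] by blast
qed

lemma never_meet_harmonic:
  assumes "fst z \<noteq> snd z"
  shows "average (pair_neighbours E z) (never_meet E) = never_meet E z"
proof -
  have "(\<lambda>n. avoid_prob E (Suc n) z) \<longlonglongrightarrow> never_meet E z"
    by (rule LIMSEQ_Suc[OF avoid_prob_tendsto])
  moreover have "(\<lambda>n. avoid_prob E (Suc n) z)
      \<longlonglongrightarrow> average (pair_neighbours E z) (never_meet E)"
    using assms unfolding average_def divide_inverse avoid_prob.simps
    by (auto intro!: tendsto_intros avoid_prob_tendsto)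
  ultimately show ?thesis using LIMSEQ_unique by blast
qed

section \<open>From avoidance probabilities to collisions\<close>

text \<open>
  The Markov property without division: a history of probability zero has extensions of
  probability zero only, so the product formula needs no positivity.
\<close>

lemma (in simple_random_walk) prob_path_Suc:
  "\<P>(\<omega> in M. \<forall>i\<le>Suc n. X i \<omega> = x i) =
     \<P>(\<omega> in M. \<forall>i\<le>n. X i \<omega> = x i) * pmf (pmf_of_set (neighbours E (x n))) (x (Suc n))"
proof -
  have eq: "{\<omega> \<in> space M. \<forall>i\<le>Suc n. X i \<omega> = x i} =
      {\<omega> \<in> space M. X (Suc n) \<omega> = x (Suc n) \<and> (\<forall>i\<le>n. X i \<omega> = x i)}"
    by (auto simp: le_Suc_eq)
  have meas: "{\<omega> \<in> space M. \<forall>i\<le>n. X i \<omega> = x i} \<in> sets M"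
    using measurable_walk by measurable
  show ?thesis
  proof (cases "\<P>(\<omega> in M. \<forall>i\<le>n. X i \<omega> = x i) > 0")
    case True
    from walk_step[OF this, of "x (Suc n)"] True show ?thesis
      unfolding cond_prob_def eq by (simp add: field_simps)
  next
    case False
    then have 0: "\<P>(\<omega> in M. \<forall>i\<le>n. X i \<omega> = x i) = 0"
      by (simp add: zero_less_measure_iff)
    have "\<P>(\<omega> in M. \<forall>i\<le>Suc n. X i \<omega> = x i) \<le> \<P>(\<omega> in M. \<forall>i\<le>n. X i \<omega> = x i)"
      by (rule finite_measure_mono[OF _ meas]) (simp add: subset_eq)
    then show ?thesis using 0 by (simp add: measure_le_0_iff)
  qed
qed

lemma (in simple_random_walk) prob_path_0:
  assumes "x 0 \<noteq> start"
  shows "\<P>(\<omega> in M. \<forall>i\<le>0. X i \<omega> = x i) = 0"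
proof -
  have "AE \<omega> in M. \<omega> \<notin> {\<omega> \<in> space M. \<forall>i\<le>0. X i \<omega> = x i}"
    using walk_start by eventually_elim (use assms in auto)
  then have "{\<omega> \<in> space M. \<forall>i\<le>0. X i \<omega> = x i} \<in> null_sets M"
    using measurable_walk by (subst AE_iff_null_sets) auto
  then show ?thesis by (simp add: measure_eq_0_null_sets)
qed

text \<open>
  The set \<open>R\<close> contains all pairs of positions that the walkers can occupy at the same time. On the
  comb it records that walkers with a common start stay at even distance.
\<close>

locale independent_walks =
  A: simple_random_walk M E start X + B: simple_random_walk M E start X'
  for M :: "'a measure" and E :: "'v :: countable set set" and start X X' +
  fixes R :: "('v \<times> 'v) set"
  assumes indep: "A.indep_var
           (Pi\<^sub>M UNIV (\<lambda>n. count_space UNIV)) (\<lambda>\<omega> n. X n \<omega>)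
           (Pi\<^sub>M UNIV (\<lambda>n. count_space UNIV)) (\<lambda>\<omega> n. X' n \<omega>)"
    and start_R: "(start, start) \<in> R"
    and step_R: "\<And>z. z \<in> R \<Longrightarrow> pair_neighbours E z \<subseteq> R"
    and neighbours_R: "\<And>z. z \<in> R \<Longrightarrow>
      finite (neighbours E (fst z)) \<and> finite (neighbours E (snd z)) \<and>
      neighbours E (fst z) \<noteq> {} \<and> neighbours E (snd z) \<noteq> {}"
begin

abbreviation Z :: "nat \<Rightarrow> 'a \<Rightarrow> 'v \<times> 'v" where
  "Z n \<omega> \<equiv> (X n \<omega>, X' n \<omega>)"

lemma measurable_steps [measurable]:
  "X n \<in> M \<rightarrow>\<^sub>M count_space UNIV" "X' n \<in> M \<rightarrow>\<^sub>M count_space UNIV"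
  by (rule A.measurable_walk, rule B.measurable_walk)

definition path_prob :: "nat \<Rightarrow> (nat \<Rightarrow> 'v \<times> 'v) \<Rightarrow> real" where
  "path_prob n z = \<P>(\<omega> in M. \<forall>i\<le>n. Z i \<omega> = z i)"

lemma path_prob_product:
  "path_prob n z = \<P>(\<omega> in M. \<forall>i\<le>n. X i \<omega> = fst (z i)) * \<P>(\<omega> in M. \<forall>i\<le>n. X' i \<omega> = snd (z i))"
proof -
  have cyl: "{\<xi> \<in> space (Pi\<^sub>M UNIV (\<lambda>n. count_space UNIV)). \<forall>i\<le>n. \<xi> i = x i}
      \<in> sets (Pi\<^sub>M UNIV (\<lambda>n. count_space (UNIV :: 'v set)))" for x :: "nat \<Rightarrow> 'v"
    by measurable
  from A.indep_varD[OF indep cyl[of "\<lambda>i. fst (z i)"] cyl[of "\<lambda>i. snd (z i)"]]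
  show ?thesis unfolding path_prob_def
    by (simp add: space_PiM vimage_def prod_eq_iff Int_def conj_commute all_conj_distrib imp_conjR)
qed

lemma path_prob_Suc:
  "path_prob (Suc n) z = path_prob n z *
     (pmf (pmf_of_set (neighbours E (fst (z n)))) (fst (z (Suc n))) *
      pmf (pmf_of_set (neighbours E (snd (z n)))) (snd (z (Suc n))))"
  by (simp only: path_prob_product A.prob_path_Suc B.prob_path_Suc mult_ac)

lemma path_prob_cong: "(\<And>i. i \<le> n \<Longrightarrow> z i = z' i) \<Longrightarrow> path_prob n z = path_prob n z'"
  unfolding path_prob_def by (metis (no_types, lifting))

lemma path_prob_pos_in_R: "path_prob n z \<noteq> 0 \<Longrightarrow> z n \<in> R"
proof (induction n)
  case 0
  then have "fst (z 0) = start" "snd (z 0) = start"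
    using A.prob_path_0[of "\<lambda>i. fst (z i)"] B.prob_path_0[of "\<lambda>i. snd (z i)"]
    by (auto simp: path_prob_product)
  then show ?case using start_R by (metis prod.collapse)
next
  case (Suc n)
  from Suc.prems have R: "z n \<in> R" using Suc.IH by (auto simp: path_prob_Suc)
  then have "z (Suc n) \<in> pair_neighbours E (z n)"
    using Suc.prems neighbours_R[OF R]
    by (auto simp: path_prob_Suc pair_neighbours_def indicator_def mem_Times_iff split: if_splits)
  then show ?case using step_R[OF R] by auto
qed

lemma path_prob_step:
  assumes "z n \<in> R" "z' \<in> pair_neighbours E (z n)"
  shows "path_prob (Suc n) (z(Suc n := z')) = path_prob n z / card (pair_neighbours E (z n))"
proof -
  have "path_prob n (z(Suc n := z')) = path_prob n z"
    by (rule path_prob_cong) auto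
  then show ?thesis
    using neighbours_R[OF assms(1)] assms(2)
    by (auto simp: path_prob_Suc pair_neighbours_def card_cartesian_product mem_Times_iff)
qed

text \<open>
  The Markov property in the form that is needed: given the history up to time \<open>s\<close>, the walkers avoid
  each other for \<open>n\<close> more steps with probability at most \<open>avoid_prob E n\<close> at their current positions.
  The induction extends the history by one step; the extensions by neighbouring pairs
  exhaust it up to a null set, because their probabilities add up to that of the history.
\<close>

lemma avoid_after_path:
  "\<P>(\<omega> in M. (\<forall>i\<le>s. Z i \<omega> = z i) \<and> (\<forall>i\<in>{s..s + n}. X i \<omega> \<noteq> X' i \<omega>))
     \<le> path_prob s z * avoid_prob E n (z s)"
proof (induction n arbitrary: s z)
  case 0
  show ?case
  proof (cases "fst (z s) = snd (z s)")
    case True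
    then have "{\<omega> \<in> space M. (\<forall>i\<le>s. Z i \<omega> = z i) \<and> (\<forall>i\<in>{s..s + 0}. X i \<omega> \<noteq> X' i \<omega>)} = {}"
      by (auto simp: prod_eq_iff)
    then show ?thesis using True by (simp only: measure_empty) simp
  next
    case False
    then show ?thesis unfolding path_prob_def
      by (simp, intro A.finite_measure_mono) (blast, measurable)
  qed
next
  case (Suc n)
  let ?P = "{\<omega> \<in> space M. \<forall>i\<le>s. Z i \<omega> = z i}"
  let ?L = "{\<omega> \<in> space M. (\<forall>i\<le>s. Z i \<omega> = z i) \<and> (\<forall>i\<in>{s..s + Suc n}. X i \<omega> \<noteq> X' i \<omega>)}"
  let ?nb = "pair_neighbours E (z s)"
  let ?C = "\<lambda>z'. {\<omega> \<in> space M. \<forall>i\<le>Suc s. Z i \<omega> = (z(Suc s := z')) i}"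
  let ?D = "\<lambda>z'. {\<omega> \<in> space M. (\<forall>i\<le>Suc s. Z i \<omega> = (z(Suc s := z')) i) \<and>
                (\<forall>i\<in>{Suc s..Suc s + n}. X i \<omega> \<noteq> X' i \<omega>)}"
  have [measurable]: "?P \<in> sets M" "\<And>z'. ?C z' \<in> sets M" "\<And>z'. ?D z' \<in> sets M"
    by measurable
  have LP: "measure M ?L \<le> path_prob s z"
    unfolding path_prob_def by (rule A.finite_measure_mono) (blast, measurable)
  consider "path_prob s z = 0" | "fst (z s) = snd (z s)"
    | "path_prob s z \<noteq> 0" "fst (z s) \<noteq> snd (z s)" by blast
  then show ?case
  proof cases
    case 1
    then show ?thesis using LP by simp
  next
    case 2
    then have "X s \<omega> = X' s \<omega>" if "Z s \<omega> = z s" for \<omega>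
      using that by (metis fst_conv snd_conv)
    then have "?L = {}" by force
    then show ?thesis using 2 by (simp only: measure_empty) simp
  next
    case 3
    have R: "z s \<in> R" by (rule path_prob_pos_in_R[OF 3(1)])
    have fin: "finite ?nb" "?nb \<noteq> {}"
      using neighbours_R[OF R] by (auto simp: pair_neighbours_def)
    have C: "measure M (?C z') = path_prob s z / card ?nb" if "z' \<in> ?nb" for z'
      using path_prob_step[of z s z', OF R that] by (simp only: path_prob_def)
    have CP: "(\<Union>z'\<in>?nb. ?C z') \<subseteq> ?P"
      by (auto simp: le_Suc_eq all_conj_distrib imp_conjR split: if_splits)
    have "measure M (\<Union>z'\<in>?nb. ?C z') = (\<Sum>z'\<in>?nb. measure M (?C z'))"
      by (intro A.finite_measure_finite_Union fin) (auto simp: disjoint_family_on_def)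
    also have "\<dots> = (\<Sum>z'\<in>?nb. path_prob s z / card ?nb)" by (rule sum.cong[OF refl C])
    also have "\<dots> = path_prob s z" using fin by simp
    finally have "measure M (?P - (\<Union>z'\<in>?nb. ?C z')) = 0"
      using fin CP by (subst A.finite_measure_Diff) (auto simp: path_prob_def)
    moreover have "?L \<subseteq> (\<Union>z'\<in>?nb. ?D z') \<union> (?P - (\<Union>z'\<in>?nb. ?C z'))"
      by (fastforce simp: le_Suc_eq)
    then have "measure M ?L \<le> measure M ((\<Union>z'\<in>?nb. ?D z') \<union> (?P - (\<Union>z'\<in>?nb. ?C z')))"
      using fin by (intro A.finite_measure_mono) auto
    moreover have "\<dots> \<le> measure M (\<Union>z'\<in>?nb. ?D z') + measure M (?P - (\<Union>z'\<in>?nb. ?C z'))"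
      using fin by (intro measure_Un_le) auto
    moreover have "measure M (\<Union>z'\<in>?nb. ?D z') \<le> (\<Sum>z'\<in>?nb. measure M (?D z'))"
      by (intro A.finite_measure_subadditive_finite fin) auto
    moreover have "(\<Sum>z'\<in>?nb. measure M (?D z'))
        \<le> (\<Sum>z'\<in>?nb. path_prob s z / card ?nb * avoid_prob E n z')"
    proof (rule sum_mono)
      fix z' assume "z' \<in> ?nb"
      then show "measure M (?D z') \<le> path_prob s z / card ?nb * avoid_prob E n z'"
        using Suc.IH[of "Suc s" "z(Suc s := z')"] path_prob_step[of z s z', OF R]
        by (simp only: fun_upd_same)
    qed
    ultimately have "measure M ?L \<le> (\<Sum>z'\<in>?nb. path_prob s z / card ?nb * avoid_prob E n z')"
      by linarith
    also have "\<dots> = path_prob s z * avoid_prob E (Suc n) (z s)"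
      using 3(2) by (simp add: average_def sum_divide_distrib sum_distrib_left)
    finally show ?thesis .
  qed
qed

text \<open>
  If there are only finitely many collisions, then for some \<open>s\<close> the walkers avoid each other from
  time \<open>s\<close> on, after one of countably many histories. For a given history this has probability at
  most a multiple of \<open>never_meet\<close>, that is, zero.
\<close>

lemma infinitely_many_collisions:
  assumes meet: "\<And>z. z \<in> R \<Longrightarrow> never_meet E z = 0"
  shows "AE \<omega> in M. infinite {n. X n \<omega> = X' n \<omega>}"
proof -
  have null: "AE \<omega> in M. \<not> ((\<forall>i\<le>s. Z i \<omega> = z i) \<and> (\<forall>i\<ge>s. X i \<omega> \<noteq> X' i \<omega>))" for s z
  proof -
    let ?N = "{\<omega> \<in> space M. (\<forall>i\<le>s. Z i \<omega> = z i) \<and> (\<forall>i\<ge>s. X i \<omega> \<noteq> X' i \<omega>)}"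
    have [measurable]: "?N \<in> sets M" by measurable
    have le: "measure M ?N \<le> path_prob s z * avoid_prob E n (z s)" for n
    proof -
      have "measure M ?N \<le> \<P>(\<omega> in M. (\<forall>i\<le>s. Z i \<omega> = z i) \<and> (\<forall>i\<in>{s..s + n}. X i \<omega> \<noteq> X' i \<omega>))"
        by (rule A.finite_measure_mono) (auto, measurable)
      then show ?thesis using avoid_after_path[of s z n] by linarith
    qed
    have "measure M ?N \<le> path_prob s z * never_meet E (z s)"
      by (rule LIMSEQ_le_const[OF tendsto_mult_left[OF avoid_prob_tendsto]]) (use le in auto)
    also have "\<dots> = 0" using path_prob_pos_in_R[of s z] meet[of "z s"] by force
    finally have "measure M ?N = 0" by (simp add: measure_le_0_iff)
    then have "?N \<in> null_sets M" by (simp add: A.emeasure_eq_measure null_sets_def)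
    from AE_not_in[OF this] AE_space show ?thesis by eventually_elim auto
  qed
  have "AE \<omega> in M. \<forall>zs :: ('v \<times> 'v) list. \<forall>s.
      \<not> ((\<forall>i\<le>s. Z i \<omega> = zs ! i) \<and> (\<forall>i\<ge>s. X i \<omega> \<noteq> X' i \<omega>))"
    by (simp only: AE_all_countable) (intro allI null)
  then show ?thesis
  proof eventually_elim
    case (elim \<omega>)
    have "\<exists>i\<ge>s. X i \<omega> = X' i \<omega>" for s
    proof -
      have "\<forall>i\<le>s. Z i \<omega> = map (\<lambda>i. Z i \<omega>) [0..<Suc s] ! i"
        by (auto simp del: upt_Suc)
      then show ?thesis using elim by blast
    qed
    then show ?case by (auto simp: infinite_nat_iff_unbounded_le)
  qed
qed

end


section \<open>The Green function of a strip of the comb\<close>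

lemma mem_neighbours_comb:
  "v \<in> neighbours (comb_edges f) u \<longleftrightarrow> u \<in> comb_vertices f \<and> v \<in> comb_vertices f \<and>
     (fst u = fst v \<and> \<bar>snd u - snd v\<bar> = 1 \<or>
      snd u = 0 \<and> snd v = 0 \<and> \<bar>fst u - fst v\<bar> = 1)"
  by (cases u; cases v) (auto simp: neighbours_def comb_edges_def doubleton_eq_iff)

text \<open>
  The voltage at \<open>v\<close> when a unit current enters at \<open>u\<close> and the vertices over \<open>\<plusminus> N\<close> are
  grounded. The first summand is the Green function of the interval from \<open>- N\<close> to \<open>N\<close>. The second
  is the length of the common part of the paths from \<open>u\<close> and \<open>v\<close> to the spine: half of
  \<open>\<bar>y\<bar> + \<bar>y'\<bar> - \<bar>y - y'\<bar>\<close> is \<open>min \<bar>y\<bar> \<bar>y'\<bar>\<close> if \<open>y\<close> and \<open>y'\<close> have the same sign, and \<open>0\<close> otherwise. It is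
  dropped on the teeth over \<open>\<plusminus> N\<close>, so that the function vanishes on the whole boundary.
\<close>

definition green :: "nat \<Rightarrow> int \<times> int \<Rightarrow> int \<times> int \<Rightarrow> real" where
  "green N u v =
     of_int ((int N - max (fst u) (fst v)) * (int N + min (fst u) (fst v))) / (2 * real N) +
     of_bool (fst u = fst v \<and> \<bar>fst u\<bar> < int N) *
       of_int (\<bar>snd u\<bar> + \<bar>snd v\<bar> - \<bar>snd u - snd v\<bar>) / 2"

lemma green_commute: "green N u v = green N v u"
  by (auto simp: green_def max.commute min.commute abs_minus_commute add.commute)

lemma green_boundary:
  assumes "\<bar>fst u\<bar> \<le> int N" "\<bar>fst v\<bar> \<le> int N" "\<bar>fst u\<bar> = int N \<or> \<bar>fst v\<bar> = int N"
  shows "green N u v = 0"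
proof -
  have "int N = max (fst u) (fst v) \<or> int N = - min (fst u) (fst v)"
    using assms by linarith
  moreover have "\<not> (fst u = fst v \<and> \<bar>fst u\<bar> < int N)"
    using assms by auto
  ultimately show ?thesis unfolding green_def by auto
qed

lemma average_eqI:
  assumes "finite A" "A \<noteq> {}" "(\<Sum>a\<in>A. g a - c) = 0"
  shows "average A g = c"
  using assms by (simp add: average_def sum_subtractf)

lemma sum_of_two:
  fixes g :: "'a \<Rightarrow> real"
  assumes "A = {a, b} \<inter> B" "a \<noteq> b"
  shows "sum g A = of_bool (a \<in> B) * g a + of_bool (b \<in> B) * g b"
  using assms by (cases "a \<in> B"; cases "b \<in> B") auto

text \<open>
  Along the spine the current splits at \<open>x\<close>. The unit of current lost here when \<open>x' = x\<close> comes down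
  the tooth over \<open>x\<close> if the source lies on that tooth; this balance is the spine case of
  \<open>green_harmonic\<close>.
\<close>

lemma green_spine_laplacian:
  assumes "\<bar>x'\<bar> < int N" "\<bar>x\<bar> \<le> int N"
  shows "(green N (x, y) (x' + 1, 0) - green N (x, y) (x', 0)) +
     (green N (x, y) (x' - 1, 0) - green N (x, y) (x', 0)) = - of_bool (x = x')"
proof -
  have N: "real N > 0" using assms by auto
  have g: "green N (x, y) (a, 0) =
      of_int ((int N - max x a) * (int N + min x a)) / (2 * real N)" for a
    by (simp add: green_def)
  consider "x < x'" | "x = x'" | "x > x'" by linarith
  then show ?thesis
  proof cases
    case 1
    then have "max x (x' + 1) = x' + 1" "min x (x' + 1) = x" "max x (x' - 1) = x' - 1"
      "min x (x' - 1) = x" "max x x' = x'" "min x x' = x" by auto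
    with 1 N show ?thesis unfolding g by (simp add: field_simps)
  next
    case 2
    then have "max x (x' + 1) = x' + 1" "min x (x' + 1) = x'" "max x (x' - 1) = x'"
      "min x (x' - 1) = x' - 1" "max x x' = x'" "min x x' = x'" by auto
    with 2 N show ?thesis unfolding g by (simp add: field_simps)
  next
    case 3
    then have "max x (x' + 1) = x" "min x (x' + 1) = x' + 1" "max x (x' - 1) = x"
      "min x (x' - 1) = x' - 1" "max x x' = x" "min x x' = x'" by auto
    with 3 N show ?thesis unfolding g by (simp add: field_simps)
  qed
qed

text \<open>
  Kirchhoff's law at \<open>v\<close>, away from the source \<open>u\<close>. On a tooth not carrying \<open>u\<close> the voltage is
  constant. On the tooth of \<open>u\<close> it is linear between the spine and \<open>u\<close> and constant beyond \<open>u\<close> and on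
  the other side of the spine, so that a tip with its single neighbour is no exception.
\<close>

lemma green_harmonic:
  assumes f: "\<And>x. 0 \<le> f x" and u: "u \<in> comb_vertices f" and v: "v \<in> comb_vertices f"
    and uN: "\<bar>fst u\<bar> \<le> int N" and vN: "\<bar>fst v\<bar> < int N" and neq: "u \<noteq> v"
  shows "average (neighbours (comb_edges f) v) (green N u) = green N u v"
proof (rule average_eqI)
  let ?nb = "neighbours (comb_edges f) v"
  let ?V = "comb_vertices f"
  show "finite ?nb" by (rule finite_neighbours_comb)
  show "?nb \<noteq> {}" by (rule neighbours_comb_nonempty[OF f v])
  obtain x y x' y' where [simp]: "u = (x, y)" "v = (x', y')" by (cases u, cases v)
  let ?d = "\<lambda>v'. green N u v' - green N u v"
  have up: "?d (x', b) = of_bool (x = x') * of_int (\<bar>b\<bar> - \<bar>y - b\<bar> - \<bar>y'\<bar> + \<bar>y - y'\<bar>) / 2" for b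
    using vN by (auto simp: green_def field_simps)
  show "sum ?d ?nb = 0"
  proof (cases "y' = 0")
    case True
    have nb: "?nb = {(x' + 1, 0), (x' - 1, 0)} \<union> {(x', 1), (x', - 1)} \<inter> ?V"
      using v True f by (auto simp: mem_neighbours_comb comb_vertices_def)
    have "sum ?d ?nb = sum ?d {(x' + 1, 0), (x' - 1, 0)} + sum ?d ({(x', 1), (x', - 1)} \<inter> ?V)"
      unfolding nb by (rule sum.union_disjoint) auto
    also have "sum ?d {(x' + 1, 0), (x' - 1, 0)} = - of_bool (x = x')"
      using green_spine_laplacian[of x' N x y] vN uN True by simp
    also have "sum ?d ({(x', 1), (x', - 1)} \<inter> ?V) =
        of_bool ((x', 1) \<in> ?V) * ?d (x', 1) + of_bool ((x', - 1) \<in> ?V) * ?d (x', - 1)"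
      by (rule sum_of_two) auto
    also have "\<dots> = of_bool (x = x')"
    proof (cases "x = x'")
      case eq: True
      then have "y \<noteq> 0" using neq True by auto
      then have "1 \<le> \<bar>of_int y :: real\<bar>" by linarith
      then have "(x', 1) \<in> ?V" "(x', - 1) \<in> ?V" using u eq by (auto simp: comb_vertices_def)
      then show ?thesis unfolding up using \<open>y \<noteq> 0\<close> eq True by (cases "y > 0") auto
    qed (simp only: up, simp)
    finally show ?thesis by simp
  next
    case False
    define s where "s = sgn y'"
    have s: "s = 1 \<and> y' > 0 \<or> s = - 1 \<and> y' < 0" using False by (auto simp: s_def sgn_if)
    have nb: "?nb = {(x', y' - s), (x', y' + s)} \<inter> ?V"
      using v False s by (auto simp: mem_neighbours_comb)
    \<comment> \<open>The step towards the spine is always possible; the step away from it fails at the tip.\<close>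
    have inner: "(x', y' - s) \<in> ?V" using v s f[of x'] by (auto simp: comb_vertices_def)
    have "sum ?d ?nb =
        of_bool ((x', y' - s) \<in> ?V) * ?d (x', y' - s) + of_bool ((x', y' + s) \<in> ?V) * ?d (x', y' + s)"
      by (rule sum_of_two[OF nb]) (use s in auto)
    also have "\<dots> = 0"
    proof (cases "x = x'")
      case eq: True
      then have neq': "y \<noteq> y'" using neq by auto
      show ?thesis
      proof (cases "(x', y' + s) \<in> ?V")
        case True
        have "\<bar>y' - s\<bar> + \<bar>y' + s\<bar> = 2 * \<bar>y'\<bar>" using s by auto
        moreover have "\<bar>y - (y' - s)\<bar> + \<bar>y - (y' + s)\<bar> = 2 * \<bar>y - y'\<bar>"
          using s neq' by (cases "y < y'") auto
        ultimately have "real_of_int (\<bar>y' - s\<bar> - \<bar>y - (y' - s)\<bar> - \<bar>y'\<bar> + \<bar>y - y'\<bar>) +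
            real_of_int (\<bar>y' + s\<bar> - \<bar>y - (y' + s)\<bar> - \<bar>y'\<bar> + \<bar>y - y'\<bar>) = 0"
          unfolding of_int_add[symmetric] of_int_eq_0_iff by linarith
        then show ?thesis unfolding up using inner True eq
          by (simp add: add_divide_distrib[symmetric] del: of_int_diff of_int_add of_int_abs)
      next
        case False
        \<comment> \<open>At the tip, \<open>u\<close> lies between \<open>v\<close> and the spine or on the other side of the spine.\<close>
        have "s * y < s * y'"
        proof -
          have "s * y < s * y' + 1"
          proof (rule ccontr)
            assume "\<not> s * y < s * y' + 1"
            then have "(x', y' + s) \<in> ?V"
              using s u v eq by (auto simp: comb_vertices_def)
            then show False using False by simp
          qed
          then show ?thesis using s neq' by auto
        qed
        then have "\<bar>y' - s\<bar> - \<bar>y - (y' - s)\<bar> - \<bar>y'\<bar> + \<bar>y - y'\<bar> = 0" using s by auto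
        then show ?thesis unfolding up using False by simp
      qed
    qed (simp only: up, simp)
    finally show ?thesis .
  qed
qed

text \<open>
  Average over the move of the walker at \<open>v\<close> first and over that of the walker at \<open>u\<close> second. After the
  move \<open>u'\<close> of the latter, \<open>u'\<close> is at odd distance from \<open>v\<close>, hence different from \<open>v\<close>; this is where
  parity is needed, since \<open>green N u'\<close> is not harmonic at \<open>u'\<close>.
\<close>

lemma green_pair_harmonic:
  assumes f: "\<And>x. 0 \<le> f x" and u: "u \<in> comb_vertices f" and v: "v \<in> comb_vertices f"
    and uN: "\<bar>fst u\<bar> < int N" and vN: "\<bar>fst v\<bar> < int N" and neq: "u \<noteq> v"
    and parity: "even (fst u + snd u + (fst v + snd v))"
  shows "average (pair_neighbours (comb_edges f) (u, v)) (\<lambda>z. green N (fst z) (snd z)) = green N u v"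
proof -
  let ?nb = "neighbours (comb_edges f)"
  have "average (pair_neighbours (comb_edges f) (u, v)) (\<lambda>z. green N (fst z) (snd z))
      = average (?nb u) (\<lambda>u'. average (?nb v) (green N u'))"
    by (simp add: pair_neighbours_def average_Times)
  also have "\<dots> = average (?nb u) (\<lambda>u'. green N u' v)"
  proof (intro average_cong green_harmonic f v vN)
    fix u' assume u': "u' \<in> ?nb u"
    show "u' \<in> comb_vertices f" using u' by (simp add: mem_neighbours_comb)
    show "\<bar>fst u'\<bar> \<le> int N" using u' uN by (auto simp: mem_neighbours_comb)
    have "odd (fst u + snd u + (fst u' + snd u'))"
      using u' by (auto simp: mem_neighbours_comb abs_if split: if_splits) presburger+
    then show "u' \<noteq> v" using parity by auto
  qed
  also have "\<dots> = green N u v"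
    using green_harmonic[OF f v u _ uN] neq vN by (simp add: green_commute[of N _ v])
  finally show ?thesis .
qed

section \<open>Halving the strip\<close>

definition even_pairs :: "(int \<Rightarrow> real) \<Rightarrow> ((int \<times> int) \<times> (int \<times> int)) set" where
  "even_pairs f = {(u, v). u \<in> comb_vertices f \<and> v \<in> comb_vertices f \<and>
     even (fst u + snd u + (fst v + snd v))}"

definition box_pairs :: "(int \<Rightarrow> real) \<Rightarrow> nat \<Rightarrow> ((int \<times> int) \<times> (int \<times> int)) set" where
  "box_pairs f N = {(u, v) \<in> even_pairs f. \<bar>fst u\<bar> \<le> int N \<and> \<bar>fst v\<bar> \<le> int N}"

lemma breve_ge: "\<bar>x\<bar> \<le> int N \<Longrightarrow> f x \<le> breve f N"
  unfolding breve_def by (intro max.coboundedI2 Max_ge imageI) auto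

lemma breve_ge_1: "1 \<le> breve f N"
  by (simp add: breve_def)

lemma breve_mono: "M \<le> N \<Longrightarrow> breve f M \<le> breve f N"
  unfolding breve_def by (intro max.mono order_refl Max_mono) auto

lemma even_pairs_neighbours: "z \<in> even_pairs f \<Longrightarrow> pair_neighbours (comb_edges f) z \<subseteq> even_pairs f"
proof
  fix z' assume z: "z \<in> even_pairs f" and z': "z' \<in> pair_neighbours (comb_edges f) z"
  have odd: "odd (fst u + snd u + (fst u' + snd u'))" if "u' \<in> neighbours (comb_edges f) u" for u u'
    using that by (auto simp: mem_neighbours_comb abs_if split: if_splits) presburger+
  show "z' \<in> even_pairs f"
    using z z' odd[of "fst z'" "fst z"] odd[of "snd z'" "snd z"]
    by (auto simp: even_pairs_def pair_neighbours_def mem_neighbours_comb)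
qed

lemma finite_box_pairs: "finite (box_pairs f N)"
proof -
  let ?H = "\<lceil>breve f N\<rceil>"
  have "u \<in> {- int N..int N} \<times> {- ?H..?H}" if "u \<in> comb_vertices f" "\<bar>fst u\<bar> \<le> int N" for u
  proof -
    have "\<bar>of_int (snd u)\<bar> \<le> breve f N"
      using breve_ge[OF that(2), of f] that(1) by (auto simp: comb_vertices_def)
    then have "\<bar>snd u\<bar> \<le> ?H" by linarith
    then show ?thesis using that(2) by (cases u) auto
  qed
  then have "box_pairs f N \<subseteq>
      ({- int N..int N} \<times> {- ?H..?H}) \<times> ({- int N..int N} \<times> {- ?H..?H})"
    unfolding box_pairs_def even_pairs_def by blast
  then show ?thesis by (rule finite_subset) auto
qed

lemma green_diagonal_le:
  assumes "u \<in> comb_vertices f" "\<bar>fst u\<bar> \<le> int N" "N > 0"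
  shows "green N u u \<le> real N / 2 + breve f N"
proof -
  have "\<bar>of_int (snd u)\<bar> \<le> breve f N"
    using breve_ge[OF assms(2), of f] assms(1) by (auto simp: comb_vertices_def)
  moreover have "(real N - of_int (fst u)) * (real N + of_int (fst u)) / (2 * real N) \<le> real N / 2"
    using assms(3) by (simp add: field_simps power2_eq_square)
  ultimately show ?thesis
    using breve_ge_1[of f N] by (auto simp: green_def)
qed

lemma green_central_ge:
  assumes "\<bar>fst u\<bar> \<le> int N" "\<bar>fst v\<bar> \<le> int N" "N > 0"
  shows "real N / 4 \<le> green (2 * N) u v"
proof -
  let ?a = "int (2 * N) - max (fst u) (fst v)" and ?b = "int (2 * N) + min (fst u) (fst v)"
  have "int N * int N \<le> ?a * ?b" using assms by (intro mult_mono) auto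
  then have "real_of_int (int N * int N) \<le> of_int (?a * ?b)" by (simp only: of_int_le_iff)
  then have "real N * real N / (2 * real (2 * N)) \<le> of_int (?a * ?b) / (2 * real (2 * N))"
    by (intro divide_right_mono) auto
  moreover have "0 \<le> of_bool (fst u = fst v \<and> \<bar>fst u\<bar> < int (2 * N)) *
       real_of_int (\<bar>snd u\<bar> + \<bar>snd v\<bar> - \<bar>snd u - snd v\<bar>) / 2"
    by (intro divide_nonneg_nonneg mult_nonneg_nonneg) (auto simp flip: of_int_add of_int_diff)
  moreover have "real N * real N / (2 * real (2 * N)) = real N / 4" using assms(3) by simp
  ultimately show ?thesis unfolding green_def by linarith
qed

text \<open>
  Compare the two functions of the pair that are harmonic off the diagonal. With \<open>D = N / 2 + breve f N\<close>,
  the function \<open>(1 - green N u v / D) * S\<close> dominates \<open>never_meet\<close> where one walker is at the boundary, since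
  \<open>green N\<close> is \<open>0\<close> there, and on the diagonal, since \<open>never_meet\<close> is \<open>0\<close> there and \<open>green N\<close> is at most \<open>D\<close>.
  By the minimum principle it dominates throughout the strip.
\<close>

lemma never_meet_strip:
  assumes f: "\<And>x. 0 \<le> f x" and N: "N > 0" and z: "z \<in> box_pairs f N"
    and S: "\<And>z. z \<in> box_pairs f N \<Longrightarrow> never_meet (comb_edges f) z \<le> S"
  shows "never_meet (comb_edges f) z \<le> (1 - green N (fst z) (snd z) / (real N / 2 + breve f N)) * S"
proof -
  define D where "D = real N / 2 + breve f N"
  have D: "D > 0" using breve_ge_1[of f N] by (simp add: D_def add_nonneg_pos)
  have S0: "0 \<le> S" using S[OF z] never_meet_nonneg[of "comb_edges f" z] by linarith
  let ?E = "comb_edges f"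
  let ?w = "\<lambda>z. (1 - green N (fst z) (snd z) / D) * S - never_meet ?E z"
  let ?I = "{(u, v). \<bar>fst u\<bar> < int N \<and> \<bar>fst v\<bar> < int N \<and> u \<noteq> v}"
  \<comment> \<open>The rank is the distance of the first walker from \<open>(N, 0)\<close>.\<close>
  let ?rank = "\<lambda>z :: (int \<times> int) \<times> (int \<times> int). nat (\<bar>snd (fst z)\<bar> + (int N - fst (fst z)))"
  have "0 \<le> ?w z"
  proof (rule minimum_principle[where D = "box_pairs f N" and I = ?I and rank = ?rank
        and nb = "pair_neighbours ?E"])
    show "finite (box_pairs f N)" by (rule finite_box_pairs)
    show "z \<in> box_pairs f N" by (rule z)
  next
    fix z assume z: "z \<in> box_pairs f N" "z \<notin> ?I"
    obtain u v where uv: "z = (u, v)" by (cases z)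
    show "0 \<le> ?w z"
    proof (cases "u = v")
      case True
      have "green N u u \<le> D"
        unfolding D_def using z uv N
        by (intro green_diagonal_le) (auto simp: box_pairs_def even_pairs_def)
      then have "green N u u / D \<le> 1" using D by simp
      then have "0 \<le> (1 - green N u u / D) * S" using S0 by (intro mult_nonneg_nonneg) auto
      then show ?thesis using never_meet_diagonal[of z ?E] uv True by simp
    next
      case False
      then have "green N u v = 0"
        using z uv by (intro green_boundary) (auto simp: box_pairs_def)
      then show ?thesis using S[OF z(1)] uv by simp
    qed
  next
    fix z assume z: "z \<in> box_pairs f N" "z \<in> ?I"
    obtain u v where uv: "z = (u, v)" by (cases z)
    have uV: "u \<in> comb_vertices f" and vV: "v \<in> comb_vertices f"
      using z uv by (auto simp: box_pairs_def even_pairs_def)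
    show "pair_neighbours ?E z \<subseteq> box_pairs f N"
    proof
      fix z' assume z': "z' \<in> pair_neighbours ?E z"
      then have "z' \<in> even_pairs f"
        using even_pairs_neighbours[of z f] z(1) by (auto simp: box_pairs_def)
      then show "z' \<in> box_pairs f N"
        using z' z(2) uv by (auto simp: box_pairs_def pair_neighbours_def mem_neighbours_comb)
    qed
    have nb: "finite (pair_neighbours ?E z)" "pair_neighbours ?E z \<noteq> {}"
      using finite_neighbours_comb neighbours_comb_nonempty[OF f] uV vV uv
      by (auto simp: pair_neighbours_def)
    have "average (pair_neighbours ?E z) (\<lambda>z. green N (fst z) (snd z)) = green N u v"
      unfolding uv
      by (rule green_pair_harmonic) (use z uv f in \<open>auto simp: box_pairs_def even_pairs_def\<close>)
    moreover have "average (pair_neighbours ?E z) (never_meet ?E) = never_meet ?E z"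
      using z uv by (intro never_meet_harmonic) auto
    moreover have "average (pair_neighbours ?E z) ?w =
        average (pair_neighbours ?E z) (\<lambda>z. S - S / D * green N (fst z) (snd z) - never_meet ?E z)"
      by (rule average_cong) (simp add: left_diff_distrib)
    moreover have "\<dots> = S - S / D * average (pair_neighbours ?E z) (\<lambda>z. green N (fst z) (snd z))
          - average (pair_neighbours ?E z) (never_meet ?E)"
      by (simp only: average_diff average_cmult average_const[OF nb])
    ultimately show "average (pair_neighbours ?E z) ?w \<le> ?w z"
      using uv by (simp add: algebra_simps)
    obtain v' where v': "v' \<in> neighbours ?E v" using neighbours_comb_nonempty[OF f vV] by blast
    \<comment> \<open>The first walker goes down to the spine and then right; the second moves anywhere.\<close>
    define u' where "u' = (if snd u = 0 then (fst u + 1, 0) else (fst u, snd u - sgn (snd u)))"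
    have "u' \<in> neighbours ?E u"
      using uV f[of "fst u"] f[of "fst u + 1"]
      by (cases u) (auto simp: u'_def mem_neighbours_comb comb_vertices_def sgn_if)
    then have "(u', v') \<in> pair_neighbours ?E z" using uv v' by (simp add: pair_neighbours_def)
    moreover have "?rank (u', v') < ?rank z" using z uv by (auto simp: u'_def sgn_if)
    ultimately show "\<exists>z'\<in>pair_neighbours ?E z. ?rank z' < ?rank z" by blast
  qed
  then show ?thesis by (simp add: D_def)
qed

text \<open>
  A lower bound for the meeting probability in the strip of half-width \<open>2 ^ Suc k\<close>, for
  walkers that start in its inner half.
\<close>

definition scale_gain :: "(int \<Rightarrow> real) \<Rightarrow> nat \<Rightarrow> real" where
  "scale_gain f k = 2 ^ k / (4 * (2 ^ k + breve f (2 ^ Suc k)))"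

lemma scale_gain_bounds: "0 \<le> scale_gain f k" "scale_gain f k \<le> 1 / 4"
proof -
  have b: "0 < breve f (2 ^ Suc k)" using breve_ge_1[of f "2 ^ Suc k"] by linarith
  then show "0 \<le> scale_gain f k" by (auto simp: scale_gain_def)
  have "0 < 4 * (2 ^ k + breve f (2 ^ Suc k))" using b by (intro mult_pos_pos add_pos_pos) auto
  then show "scale_gain f k \<le> 1 / 4"
    unfolding scale_gain_def using b by (subst pos_divide_le_eq) auto
qed

lemma never_meet_halving:
  assumes f: "\<And>x. 0 \<le> f x" and z: "z \<in> box_pairs f (2 ^ k)"
    and S: "\<And>z. z \<in> box_pairs f (2 ^ Suc k) \<Longrightarrow> never_meet (comb_edges f) z \<le> S"
  shows "never_meet (comb_edges f) z \<le> (1 - scale_gain f k) * S"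
proof -
  let ?g = "green (2 ^ Suc k) (fst z) (snd z)" and ?D = "2 ^ k + breve f (2 ^ Suc k)"
  have z': "z \<in> box_pairs f (2 ^ Suc k)" using z by (auto simp: box_pairs_def)
  have S0: "0 \<le> S" using S[OF z'] never_meet_nonneg[of "comb_edges f" z] by linarith
  have D: "?D > 0" using breve_ge_1[of f "2 ^ Suc k"] by (intro add_pos_pos) auto
  have "2 ^ k / 4 \<le> ?g"
    using green_central_ge[of "fst z" "2 ^ k" "snd z"] z by (auto simp: box_pairs_def)
  then have "2 ^ k / 4 / ?D \<le> ?g / ?D" using D by (intro divide_right_mono) auto
  then have "scale_gain f k \<le> ?g / ?D" by (simp add: scale_gain_def mult.commute)
  then have "(1 - ?g / ?D) * S \<le> (1 - scale_gain f k) * S"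
    using S0 by (intro mult_right_mono) auto
  moreover have "never_meet (comb_edges f) z \<le> (1 - ?g / ?D) * S"
    using never_meet_strip[OF f _ z' S] by simp
  ultimately show ?thesis by linarith
qed

lemma never_meet_le_prod:
  assumes f: "\<And>x. 0 \<le> f x" and z: "z \<in> box_pairs f (2 ^ k)"
  shows "never_meet (comb_edges f) z \<le> (\<Prod>j<n. 1 - scale_gain f (k + j))"
  using z
proof (induction n arbitrary: k z)
  case 0
  then show ?case by (simp add: never_meet_le_1)
next
  case (Suc n)
  have "never_meet (comb_edges f) z
      \<le> (1 - scale_gain f k) * (\<Prod>j<n. 1 - scale_gain f (Suc k + j))"
    using Suc.IH[of _ "Suc k"] by (intro never_meet_halving[OF f Suc.prems])
  then show ?case by (simp add: prod.lessThan_Suc_shift del: prod.lessThan_Suc)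
qed

text \<open>
  If the gains are summable, then they tend to zero, which forces \<open>breve f (2 ^ Suc k) > 2 ^ k\<close> for large \<open>k\<close>.
  From then on the term \<open>2 ^ k\<close> in the denominator costs at most a factor \<open>2\<close>, and
  \<open>2 ^ k / breve f (2 ^ Suc k)\<close> is summable as well. This contradicts the divergence by Cauchy condensation.
\<close>

lemma scale_gain_not_summable:
  assumes div: "filterlim (\<lambda>N. \<Sum>n=1..N. 1 / breve f n) at_top sequentially"
  shows "\<not> summable (scale_gain f)"
proof
  assume sum: "summable (scale_gain f)"
  let ?F = "\<lambda>k. breve f (2 ^ Suc k)"
  have pos: "0 < breve f n" for n using breve_ge_1[of f n] by linarith
  \<comment> \<open>\<open>1 / 8\<close> is the gain at \<open>breve f (2 ^ Suc k) = 2 ^ k\<close>.\<close>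
  have "eventually (\<lambda>k. scale_gain f k < 1 / 8) sequentially"
    by (rule order_tendstoD(2)[OF summable_LIMSEQ_zero[OF sum]]) simp
  then have "eventually (\<lambda>k. norm (2 ^ k / ?F k) \<le> 8 * scale_gain f k) sequentially"
  proof eventually_elim
    case (elim k)
    have "2 ^ k < ?F k" using elim pos[of "2 ^ Suc k"]
      by (simp add: scale_gain_def divide_less_eq add_pos_pos)
    then have "2 ^ k / (2 * ?F k) \<le> 2 ^ k / (2 ^ k + ?F k)"
      using pos[of "2 ^ Suc k"] by (intro divide_left_mono mult_pos_pos add_pos_pos) auto
    then have "2 * (2 ^ k / (2 * ?F k)) \<le> 2 * (2 ^ k / (2 ^ k + ?F k))" by (rule mult_left_mono) simp
    moreover have "2 * b = 8 * (b / 4)" for b :: real by simp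
    moreover have "2 ^ k / (2 ^ k + ?F k) / 4 = scale_gain f k" by (simp add: scale_gain_def)
    moreover have "norm (2 ^ k / ?F k) = 2 * (2 ^ k / (2 * ?F k))"
      using pos[of "2 ^ Suc k"] by simp
    ultimately show ?case by metis
  qed
  then have "summable (\<lambda>k. 2 ^ k / ?F k)"
    by (rule summable_comparison_test_ev) (intro summable_mult sum)
  then have "summable (\<lambda>k. 2 * (2 ^ k / ?F k))" by (rule summable_mult)
  then have "summable (\<lambda>k. 2 ^ Suc k * (1 / ?F k))" by simp
  then have "summable (\<lambda>k. 2 ^ k * (1 / breve f (2 ^ k)))"
    by (subst summable_Suc_iff[symmetric])
  moreover have "1 / breve f (Suc m) \<le> 1 / breve f m" for m
    using pos breve_mono[of m "Suc m" f] by (intro divide_left_mono mult_pos_pos) auto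
  ultimately have s: "summable (\<lambda>n. 1 / breve f n)"
    using pos by (subst condensation_test) (auto intro: less_imp_le)
  have "(\<Sum>n=1..N. 1 / breve f n) \<le> (\<Sum>n. 1 / breve f n)" for N
    using pos by (intro sum_le_suminf s) (auto intro: less_imp_le)
  moreover have "eventually (\<lambda>N. (\<Sum>n. 1 / breve f n) < (\<Sum>n=1..N. 1 / breve f n)) sequentially"
    using div by (simp only: filterlim_at_top_dense)
  then have "\<exists>N. (\<Sum>n. 1 / breve f n) < (\<Sum>n=1..N. 1 / breve f n)"
    by (rule eventually_happens'[OF sequentially_bot])
  ultimately show False by (metis not_le)
qed

lemma never_meet_eq_0:
  assumes f: "\<And>x. 0 \<le> f x"
    and div: "filterlim (\<lambda>N. \<Sum>n=1..N. 1 / breve f n) at_top sequentially"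
    and z: "z \<in> even_pairs f"
  shows "never_meet (comb_edges f) z = 0"
proof (rule ccontr)
  let ?q = "never_meet (comb_edges f) z"
  assume "?q \<noteq> 0"
  then have q: "0 < ?q" using never_meet_nonneg[of "comb_edges f" z] by linarith
  define k where "k = nat (max \<bar>fst (fst z)\<bar> \<bar>fst (snd z)\<bar>)"
  have "\<bar>fst (fst z)\<bar> \<le> int k" "\<bar>fst (snd z)\<bar> \<le> int k" by (auto simp: k_def)
  moreover have "int k \<le> int (2 ^ k)" using less_exp[of k] by linarith
  ultimately have "\<bar>fst (fst z)\<bar> \<le> int (2 ^ k)" "\<bar>fst (snd z)\<bar> \<le> int (2 ^ k)" by linarith+
  then have box: "z \<in> box_pairs f (2 ^ k)"
    using z by (cases z) (simp add: box_pairs_def)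
  have "(\<Sum>j<n. scale_gain f (j + k)) \<le> - ln ?q" for n
  proof -
    have "?q \<le> (\<Prod>j<n. 1 - scale_gain f (k + j))" by (rule never_meet_le_prod[OF f box])
    also have "\<dots> \<le> (\<Prod>j<n. exp (- scale_gain f (k + j)))"
    proof (intro prod_mono conjI)
      fix j
      show "0 \<le> 1 - scale_gain f (k + j)" using scale_gain_bounds(2)[of f "k + j"] by linarith
      show "1 - scale_gain f (k + j) \<le> exp (- scale_gain f (k + j))"
        using exp_ge_add_one_self[of "- scale_gain f (k + j)"] by simp
    qed
    also have "\<dots> = exp (- (\<Sum>j<n. scale_gain f (j + k)))"
      by (simp add: exp_sum sum_negf[symmetric] add.commute)
    finally have "ln ?q \<le> ln (exp (- (\<Sum>j<n. scale_gain f (j + k))))"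
      using q by (subst ln_le_cancel_iff) auto
    then have "ln ?q \<le> - (\<Sum>j<n. scale_gain f (j + k))" by simp
    then show ?thesis by linarith
  qed
  then have "summable (\<lambda>j. scale_gain f (j + k))"
    by (intro bounded_imp_summable[where B = "- ln ?q"] scale_gain_bounds(1))
      (metis lessThan_Suc_atMost)
  then have "summable (scale_gain f)" by (simp add: summable_iff_shift)
  then show False using scale_gain_not_summable[OF div] by simp
qed

theorem theorem1p1:
  fixes f :: "int \<Rightarrow> real" and start :: "int \<times> int"
    and M :: "'a measure" and X X' :: "nat \<Rightarrow> 'a \<Rightarrow> int \<times> int"
  assumes "\<And>x. 0 \<le> f x"
    and "filterlim (\<lambda>N. \<Sum>n=1..N. 1 / breve f n) at_top sequentially"
    and "start \<in> comb_vertices f"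
    and "simple_random_walk M (comb_edges f) start X"
    and "simple_random_walk M (comb_edges f) start X'"
    and "prob_space.indep_var M
           (Pi\<^sub>M UNIV (\<lambda>n. count_space UNIV)) (\<lambda>\<omega> n. X n \<omega>)
           (Pi\<^sub>M UNIV (\<lambda>n. count_space UNIV)) (\<lambda>\<omega> n. X' n \<omega>)"
  shows "AE \<omega> in M. infinite {n. X n \<omega> = X' n \<omega>}"
proof -
  interpret A: simple_random_walk M "comb_edges f" start X by fact
  interpret B: simple_random_walk M "comb_edges f" start X' by fact
  interpret independent_walks M "comb_edges f" start X X' "even_pairs f"
  proof
    show "(start, start) \<in> even_pairs f" using assms(3) by (simp add: even_pairs_def)
    show "pair_neighbours (comb_edges f) z \<subseteq> even_pairs f" if "z \<in> even_pairs f" for z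
      by (rule even_pairs_neighbours[OF that])
    show "finite (neighbours (comb_edges f) (fst z)) \<and> finite (neighbours (comb_edges f) (snd z)) \<and>
        neighbours (comb_edges f) (fst z) \<noteq> {} \<and> neighbours (comb_edges f) (snd z) \<noteq> {}"
      if "z \<in> even_pairs f" for z
      using that neighbours_comb_nonempty[OF assms(1)] finite_neighbours_comb
      by (auto simp: even_pairs_def)
  qed fact
  show ?thesis by (rule infinitely_many_collisions[OF never_meet_eq_0[OF assms(1,2)]])
qed

end
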